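(* Let $G$ be a countable semi-group. Then the space $LO(G)$ of left orders on $G$ is a compact, totally disconnected topological space.
   Context: A semi-group is a set with an associative binary operation. A left order on a semi-group $G$ is a (strict) linear order $<$ on $G$ such that $a<b$ implies $ca<cb$ for all $a,b,c\in G$. $LO(G)$ denotes the set of all left orders on $G$, endowed with the smallest topology for which all the sets $U_{a,b}=\{<\,\in LO(G): a<b\}$, $a,b\in G$, are open. A space is called totally disconnected if every two distinct points of it are contained in two disjoint open sets (one point in each) covering the space. *)

theory Defs
  imports "HOL-Analysis.Analysis"
begin

locale semigroup_on =
  fixes G :: "'a set" and f :: "'a \<Rightarrow> 'a \<Rightarrow> 'a"  (infixl \<open>\<cdot>\<close> 70)
  assumes closed: "\<And>a b. a \<in> G \<Longrightarrow> b \<in> G \<Longrightarrow> a \<cdot> b \<in> G"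
    and assoc: "\<And>a b c. a \<in> G \<Longrightarrow> b \<in> G \<Longrightarrow> c \<in> G \<Longrightarrow> (a \<cdot> b) \<cdot> c = a \<cdot> (b \<cdot> c)"

text \<open>A left order is represented by its graph, the set of pairs (a, b) with a < b. The
  requirement that the graph lies in G \<times> G makes equality of relations the equality of orders on G.\<close>

definition left_order :: "'a set \<Rightarrow> ('a \<Rightarrow> 'a \<Rightarrow> 'a) \<Rightarrow> ('a \<times> 'a) set \<Rightarrow> bool" where
  "left_order G f r \<longleftrightarrow>
     r \<subseteq> G \<times> G \<and> strict_linear_order_on G r \<and>
     (\<forall>a\<in>G. \<forall>b\<in>G. \<forall>c\<in>G. (a, b) \<in> r \<longrightarrow> (f c a, f c b) \<in> r)"

definition LO :: "'a set \<Rightarrow> ('a \<Rightarrow> 'a \<Rightarrow> 'a) \<Rightarrow> ('a \<times> 'a) set set" where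
  "LO G f = {r. left_order G f r}"

definition LO_subbasic ::
    "'a set \<Rightarrow> ('a \<Rightarrow> 'a \<Rightarrow> 'a) \<Rightarrow> 'a \<Rightarrow> 'a \<Rightarrow> ('a \<times> 'a) set set" where
  "LO_subbasic G f a b = {r \<in> LO G f. (a, b) \<in> r}"

text \<open>The whole space is added to the generators because \<^const>\<open>topology_generated_by\<close> takes
  the union of the generators as the underlying space; this union would be empty when G has at
  most one element, although the empty relation is then a left order.\<close>

definition LO_topology :: "'a set \<Rightarrow> ('a \<Rightarrow> 'a \<Rightarrow> 'a) \<Rightarrow> ('a \<times> 'a) set topology" where
  "LO_topology G f =
     topology_generated_by (insert (LO G f) {LO_subbasic G f a b | a b. a \<in> G \<and> b \<in> G})"

lemma topspace_LO_topology: "topspace (LO_topology G f) = LO G f"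
  by (auto simp: LO_topology_def LO_subbasic_def)

lemma openin_LO_subbasic:
  "a \<in> G \<Longrightarrow> b \<in> G \<Longrightarrow> openin (LO_topology G f) (LO_subbasic G f a b)"
  unfolding LO_topology_def by (rule topology_generated_by_Basis) blast

lemma LO_topology_smallest:
  assumes "topspace X = LO G f"
    and "\<And>a b. a \<in> G \<Longrightarrow> b \<in> G \<Longrightarrow> openin X (LO_subbasic G f a b)"
    and "openin (LO_topology G f) U"
  shows "openin X U"
proof -
  have "generate_topology_on
      (insert (LO G f) {LO_subbasic G f a b | a b. a \<in> G \<and> b \<in> G}) U"
    using assms(3) unfolding LO_topology_def by (rule openin_topology_generated_by)
  then show ?thesis
  proof induction
    case (Basis s)
    then show ?case
      using assms(2) openin_topspace[of X] unfolding assms(1) by blast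
  qed auto
qed

definition totally_disconnected_space :: "'a topology \<Rightarrow> bool" where
  "totally_disconnected_space X \<longleftrightarrow>
     (\<forall>x\<in>topspace X. \<forall>y\<in>topspace X. x \<noteq> y \<longrightarrow>
        (\<exists>U V. openin X U \<and> openin X V \<and> x \<in> U \<and> y \<in> V \<and>
               U \<inter> V = {} \<and> U \<union> V = topspace X))"

end

theory Submission
  imports Defs
begin

text \<open>
  Identify a relation on \<open>'a\<close> with its characteristic function, a point of the Cantor cube of all
  functions from \<open>'a \<times> 'a\<close> to \<open>bool\<close>, which is compact by Tychonoff's theorem.  Being a left
  order is a conjunction of conditions each of which involves at most three values of the
  characteristic function, so the left orders form a closed, hence compact, part of the cube
  (\<open>closed_left_order_functions\<close>).  The sets \<open>U\<^sub>a\<^sub>,\<^sub>b\<close> correspond to the basic clopen sets that fix one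
  value, so \<open>LO(G)\<close> is a continuous image of this compact set.

  For total disconnectedness, two distinct left orders disagree about some pair \<open>a \<noteq> b\<close>; by
  totality one of them has \<open>a < b\<close> and the other \<open>b < a\<close>.  The sets \<open>U\<^sub>a\<^sub>,\<^sub>b\<close> and \<open>U\<^sub>b\<^sub>,\<^sub>a\<close> are then
  complementary, because every left order is a strict linear order.
\<close>

text \<open>The quantifiers range over the whole type and only membership in \<open>r\<close> depends on \<open>r\<close>, so that
  the closedness rules for set comprehensions apply to the right-hand side term by term.\<close>

lemma left_order_iff:
  "left_order G f r \<longleftrightarrow>
     (\<forall>a b. (a, b) \<in> r \<longrightarrow> a \<in> G \<and> b \<in> G) \<and>
     (\<forall>a b c. (a, b) \<in> r \<longrightarrow> (b, c) \<in> r \<longrightarrow> (a, c) \<in> r) \<and>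
     (\<forall>a. (a, a) \<notin> r) \<and>
     (\<forall>a b. a \<in> G \<and> b \<in> G \<and> a \<noteq> b \<longrightarrow> (a, b) \<in> r \<or> (b, a) \<in> r) \<and>
     (\<forall>a b c. a \<in> G \<and> b \<in> G \<and> c \<in> G \<longrightarrow> (a, b) \<in> r \<longrightarrow> (f c a, f c b) \<in> r)"
  unfolding left_order_def strict_linear_order_on_def trans_def irrefl_def total_on_def
    subset_iff split_paired_All mem_Sigma_iff
  by meson

lemma left_order_swap:
  assumes "left_order G f r" "a \<in> G" "b \<in> G" "a \<noteq> b"
  shows "(b, a) \<in> r \<longleftrightarrow> (a, b) \<notin> r"
  using assms unfolding left_order_iff by blast

lemma
  shows open_coordinate: "open {h :: 'b \<Rightarrow> bool. h p}"
    and closed_coordinate: "closed {h :: 'b \<Rightarrow> bool. h p}"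
proof -
  have cont: "continuous_on UNIV (\<lambda>h :: 'b \<Rightarrow> bool. h p)"
    by (rule continuous_on_product_coordinates)
  have eq: "{h :: 'b \<Rightarrow> bool. h p} = (\<lambda>h. h p) -` {True}"
    by auto
  show "open {h :: 'b \<Rightarrow> bool. h p}"
    unfolding eq by (rule open_vimage[OF open_discrete cont])
  show "closed {h :: 'b \<Rightarrow> bool. h p}"
    unfolding eq by (rule closed_vimage[OF _ cont]) simp
qed

text \<open>Each axiom of a left order is, for fixed elements, a condition on finitely many coordinates,
  hence closed; the quantifiers over the elements become intersections.\<close>

lemma closed_left_order_functions:
  "closed {h :: 'a \<times> 'a \<Rightarrow> bool. left_order G f (Collect h)}"
  unfolding left_order_iff mem_Collect_eq
  by (intro closed_Collect_conj closed_Collect_all closed_Collect_imp closed_Collect_disj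
      closed_Collect_neg open_Collect_const closed_Collect_const
      open_coordinate closed_coordinate)

lemma compact_UNIV_bool_functions: "compact (UNIV :: ('b \<Rightarrow> bool) set)"
proof -
  have "compact_space (euclidean :: bool topology)"
    by (simp add: compact_space_def compactin_euclidean_iff finite_imp_compact)
  then have "compact_space (product_topology (\<lambda>_ :: 'b. euclidean :: bool topology) UNIV)"
    by (simp add: compact_space_product_topology)
  then show ?thesis
    by (simp add: euclidean_product_topology compact_space_def compactin_euclidean_iff)
qed

text \<open>Passing from a characteristic function to its relation is continuous, since the preimage of
  \<open>U\<^sub>a\<^sub>,\<^sub>b\<close> fixes a single coordinate; so it carries the compactness of the closed set of left order
  functions over to the space of left orders.\<close>

lemma compact_space_LO_topology: "compact_space (LO_topology G f)"
proof -
  define K where "K = {h. left_order G f (Collect h)}"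
  have image_K: "Collect ` K = LO G f"
  proof (intro equalityI subsetI)
    fix r
    assume "r \<in> LO G f"
    then show "r \<in> Collect ` K"
      by (intro image_eqI[of r Collect "\<lambda>p. p \<in> r"]) (simp_all add: K_def LO_def)
  qed (auto simp: K_def LO_def)
  have "compact K"
    using compact_Int_closed[OF compact_UNIV_bool_functions closed_left_order_functions[of G f]]
    by (simp add: K_def)
  then have "compactin (top_of_set K) K"
    by (simp add: compactin_subtopology compactin_euclidean_iff)
  moreover have "continuous_map (top_of_set K) (LO_topology G f) Collect"
    unfolding LO_topology_def
  proof (rule continuous_on_generated_topo)
    fix U
    assume "U \<in> insert (LO G f) {LO_subbasic G f a b | a b. a \<in> G \<and> b \<in> G}"
    then consider "U = LO G f" | a b where "U = LO_subbasic G f a b"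
      by auto
    then show "openin (top_of_set K) (Collect -` U \<inter> topspace (top_of_set K))"
    proof cases
      case 1
      then have "Collect -` U \<inter> topspace (top_of_set K) = K"
        using image_K by auto
      then show ?thesis by simp
    next
      case (2 a b)
      then have "Collect -` U \<inter> topspace (top_of_set K) = K \<inter> {h. h (a, b)}"
        using image_K by (auto simp: LO_subbasic_def)
      then show ?thesis
        by (simp only: openin_open_Int[OF open_coordinate])
    qed
  next
    show "Collect ` topspace (top_of_set K)
        \<subseteq> \<Union> (insert (LO G f) {LO_subbasic G f a b | a b. a \<in> G \<and> b \<in> G})"
      using image_K by auto
  qed
  ultimately have "compactin (LO_topology G f) (Collect ` K)"
    by (rule image_compactin)
  then show ?thesis
    by (simp add: image_K compact_space_def topspace_LO_topology)
qed

lemma totally_disconnected_space_LO_topology: "totally_disconnected_space (LO_topology G f)"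
  unfolding totally_disconnected_space_def topspace_LO_topology
proof (intro ballI impI)
  fix r s
  assume r: "r \<in> LO G f" and s: "s \<in> LO G f" and "r \<noteq> s"
  then obtain a b where ab: "(a, b) \<in> r \<longleftrightarrow> (a, b) \<notin> s"
    by auto
  have "a \<in> G" "b \<in> G" "a \<noteq> b"
    using r s ab unfolding LO_def mem_Collect_eq left_order_iff by metis+
  note swap = left_order_swap[OF _ this]
  let ?U = "LO_subbasic G f a b" and ?V = "LO_subbasic G f b a"
  have opens: "openin (LO_topology G f) ?U" "openin (LO_topology G f) ?V"
    using \<open>a \<in> G\<close> \<open>b \<in> G\<close> by (simp_all add: openin_LO_subbasic)
  have parts: "?U \<inter> ?V = {}" "?U \<union> ?V = LO G f"
    using swap by (auto simp: LO_subbasic_def LO_def)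
  have "r \<in> ?U \<and> s \<in> ?V \<or> r \<in> ?V \<and> s \<in> ?U"
    using r s ab swap by (auto simp: LO_subbasic_def LO_def)
  then show "\<exists>U V. openin (LO_topology G f) U \<and> openin (LO_topology G f) V \<and> r \<in> U \<and> s \<in> V \<and>
      U \<inter> V = {} \<and> U \<union> V = LO G f"
    using opens parts by (metis Int_commute Un_commute)
qed

theorem theorem1p4:
  fixes G :: "'a set" and f :: "'a \<Rightarrow> 'a \<Rightarrow> 'a"
  assumes "semigroup_on G f"
    and "countable G"
  shows "compact_space (LO_topology G f) \<and> totally_disconnected_space (LO_topology G f)"
  using compact_space_LO_topology totally_disconnected_space_LO_topology by blast

end
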